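(* Let $\chi$ be a probability distribution on $\mathbb{N}_0$ with $0\le\chi(0)<1$ and probability generating function $G(x)=\sum_{m=0}^{\infty}x^m\chi(m)$, and let $(p,q)\in[0,1]^2$ with $0<p+q<1$. Define $g_{p,q}(x)=(1-q)-(1-p-q)G(x)$ for $x\in[0,1]$ and $g_{p,q}^{(2)}=g_{p,q}\circ g_{p,q}$. Let $w$ be the probability that the bond percolation game with parameter-pair $(p,q)$ on the rooted Galton-Watson tree $T_\chi$, starting with the token at the root, is won by the player who plays the first round, and let $w'=p+(1-p-q)w$. Suppose the probability that this game results in a draw is $0$. If the derivative of $g_{p,q}$ at $x=w'$ and the derivative of $g_{p,q}^{(2)}$ at $x=w'$ are both strictly less than $1$, then the expected duration $\mathbf{E}[\mathcal{T}]$ of the game is finite.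
   Context: $\mathbb{N}_0=\{0,1,2,\dots\}$. $T_\chi$ is the rooted Galton-Watson tree with root $\phi$ in which the numbers of children of the vertices are i.i.d. with law $\chi$. Each edge $\{u,v\}$ ($u$ the parent of $v$) is directed from $u$ to $v$. Bond percolation game with parameter-pair $(p,q)$: given $T_\chi$, each edge is independently labeled trap with probability $p$, target with probability $q$, safe with probability $1-p-q$. The tree and all labels are revealed to both players (perfect information). Two players alternately move a token, initially at $\phi$; a move takes the token from its current vertex $u$ along a directed edge to a child of $u$. A player who moves the token along a target edge wins immediately; a player who moves it along a trap edge loses immediately; a player whose turn it is to move when the token is at a leaf (childless vertex) loses. If the game continues forever it is a draw. Both players play optimally: for a given realization, the game is won (respectively lost) by the first player if the first (respectively second) player has a strategy guaranteeing a win for herself in finitely many rounds against any play of the opponent; otherwise the game results in a draw. A player destined to win tries to finish as quickly as possible, and a player destined to lose tries to prolong the game as much as possible. Duration: for $n\in\mathbb{N}_0$ let $W_n$ (respectively $L_n$) be the set of vertices $v$ such that, if the token starts at $v$, the first (respectively second) player can guarantee to win within at most $n$ rounds, with $W_0=L_0=\emptyset$; a round is one turn, and a turn at a leaf (where the player cannot move and loses) counts as a round. Thus $v\in W_1$ iff some edge from $v$ to a child is a target, and $v\in L_1$ iff $v$ is childless or all edges from $v$ to its children are traps. The duration is $\mathcal{T}=\min\{n:\phi\in W_n\cup L_n\}$ (and $\mathcal{T}=\infty$ if there is no such $n$). *)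

theory Defs
  imports "HOL-Probability.Probability"
begin

text \<open>
  Vertices are Ulam--Harris words: the root is \<^term>\<open>[]\<close>, and the children of
  \<open>v\<close> are \<open>v @ [i]\<close> for \<open>i\<close> less than the number of children of \<open>v\<close>.  A configuration
  assigns to each word the number of children of that vertex and the label of the edge entering it
  from its parent.  The label of the root and the data of words outside the tree are never used.
\<close>

datatype edge_label = Trap | Target | Safe

type_synonym vertex = "nat list"
type_synonym configuration = "vertex \<Rightarrow> nat \<times> edge_label"

definition offspring :: "configuration \<Rightarrow> vertex \<Rightarrow> nat" where
  "offspring \<omega> v = fst (\<omega> v)"

definition edge_into :: "configuration \<Rightarrow> vertex \<Rightarrow> edge_label" where
  "edge_into \<omega> v = snd (\<omega> v)"

inductive_set gw_tree :: "configuration \<Rightarrow> vertex set" for \<omega> where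
  root: "[] \<in> gw_tree \<omega>"
| child: "v \<in> gw_tree \<omega> \<Longrightarrow> i < offspring \<omega> v \<Longrightarrow> v @ [i] \<in> gw_tree \<omega>"

definition label_pmf :: "real \<Rightarrow> real \<Rightarrow> edge_label pmf" where
  "label_pmf p q = pmf_of_list [(Trap, p), (Target, q), (Safe, 1 - p - q)]"

definition percolation_game :: "nat pmf \<Rightarrow> real \<Rightarrow> real \<Rightarrow> configuration measure" where
  "percolation_game chi p q =
     PiM UNIV (\<lambda>_. measure_pmf (pair_pmf chi (label_pmf p q)))"

text \<open>
  In a tree the position of the token determines the whole history of the game, so a strategy is
  a choice of a child at each vertex that has one.
\<close>

type_synonym strategy = "vertex \<Rightarrow> nat"

definition strategies :: "configuration \<Rightarrow> strategy set" where
  "strategies \<omega> = {\<sigma>. \<forall>v\<in>gw_tree \<omega>. offspring \<omega> v > 0 \<longrightarrow> \<sigma> v < offspring \<omega> v}"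

text \<open>
  Results are from the point of view of the player about to move, hence the reversal after
  each safe move.
\<close>

datatype game_result = Win | Loss | Undecided

fun reverse_result :: "game_result \<Rightarrow> game_result" where
  "reverse_result Win = Loss"
| "reverse_result Loss = Win"
| "reverse_result Undecided = Undecided"

text \<open>
  \<open>result_after \<omega> n \<sigma> \<tau> v\<close>: the status after at most \<open>n\<close> rounds of the play starting at \<open>v\<close>
  in which the player about to move follows \<open>\<sigma>\<close> and the other player follows \<open>\<tau>\<close>.
\<close>

primrec result_after ::
  "configuration \<Rightarrow> nat \<Rightarrow> strategy \<Rightarrow> strategy \<Rightarrow> vertex \<Rightarrow> game_result" where
  "result_after \<omega> 0 \<sigma> \<tau> v = Undecided"
| "result_after \<omega> (Suc n) \<sigma> \<tau> v =
     (if offspring \<omega> v = 0 then Loss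
      else case edge_into \<omega> (v @ [\<sigma> v]) of
             Target \<Rightarrow> Win
           | Trap \<Rightarrow> Loss
           | Safe \<Rightarrow> reverse_result (result_after \<omega> n \<tau> \<sigma> (v @ [\<sigma> v])))"

definition won_by_first :: "configuration \<Rightarrow> bool" where
  "won_by_first \<omega> \<longleftrightarrow>
     (\<exists>\<sigma>\<in>strategies \<omega>. \<forall>\<tau>\<in>strategies \<omega>. \<exists>n. result_after \<omega> n \<sigma> \<tau> [] = Win)"

definition lost_by_first :: "configuration \<Rightarrow> bool" where
  "lost_by_first \<omega> \<longleftrightarrow>
     (\<exists>\<tau>\<in>strategies \<omega>. \<forall>\<sigma>\<in>strategies \<omega>. \<exists>n. result_after \<omega> n \<sigma> \<tau> [] = Loss)"

definition drawn :: "configuration \<Rightarrow> bool" where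
  "drawn \<omega> \<longleftrightarrow> \<not> won_by_first \<omega> \<and> \<not> lost_by_first \<omega>"

definition W_set :: "configuration \<Rightarrow> nat \<Rightarrow> vertex set" where
  "W_set \<omega> n = {v \<in> gw_tree \<omega>.
     \<exists>\<sigma>\<in>strategies \<omega>. \<forall>\<tau>\<in>strategies \<omega>. result_after \<omega> n \<sigma> \<tau> v = Win}"

definition L_set :: "configuration \<Rightarrow> nat \<Rightarrow> vertex set" where
  "L_set \<omega> n = {v \<in> gw_tree \<omega>.
     \<exists>\<tau>\<in>strategies \<omega>. \<forall>\<sigma>\<in>strategies \<omega>. result_after \<omega> n \<sigma> \<tau> v = Loss}"

text \<open>The infimum of the empty set in \<^typ>\<open>enat\<close> is \<open>\<infinity>\<close>.\<close>

definition duration :: "configuration \<Rightarrow> enat" where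
  "duration \<omega> = (INF n\<in>{n. [] \<in> W_set \<omega> n \<union> L_set \<omega> n}. enat n)"

definition win_prob :: "nat pmf \<Rightarrow> real \<Rightarrow> real \<Rightarrow> real" where
  "win_prob chi p q =
     measure (percolation_game chi p q) {\<omega> \<in> space (percolation_game chi p q). won_by_first \<omega>}"

definition draw_prob :: "nat pmf \<Rightarrow> real \<Rightarrow> real \<Rightarrow> real" where
  "draw_prob chi p q =
     measure (percolation_game chi p q) {\<omega> \<in> space (percolation_game chi p q). drawn \<omega>}"

definition expected_duration :: "nat pmf \<Rightarrow> real \<Rightarrow> real \<Rightarrow> ennreal" where
  "expected_duration chi p q =
     (\<integral>\<^sup>+ \<omega>. ennreal_of_enat (duration \<omega>) \<partial>percolation_game chi p q)"

text \<open>
  The power series need not converge for \<open>x > 1\<close>, so derivatives of \<open>pgf\<close> and \<open>g_fun\<close> are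
  meaningful only at interior points of \<open>[0, 1]\<close>.
\<close>

definition pgf :: "nat pmf \<Rightarrow> real \<Rightarrow> real" where
  "pgf chi x = (\<Sum>m. x ^ m * pmf chi m)"

definition g_fun :: "nat pmf \<Rightarrow> real \<Rightarrow> real \<Rightarrow> real \<Rightarrow> real" where
  "g_fun chi p q x = (1 - q) - (1 - p - q) * pgf chi x"

lemma pmf_label_pmf:
  assumes "0 \<le> p" "0 \<le> q" "p + q \<le> 1"
  shows "pmf (label_pmf p q) Trap = p" "pmf (label_pmf p q) Target = q"
    "pmf (label_pmf p q) Safe = 1 - p - q"
proof -
  have "pmf_of_list_wf [(Trap, p), (Target, q), (Safe, 1 - p - q)]"
    using assms by (intro pmf_of_list_wfI) auto
  then show "pmf (label_pmf p q) Trap = p" "pmf (label_pmf p q) Target = q"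
    "pmf (label_pmf p q) Safe = 1 - p - q"
    by (simp_all add: label_pmf_def pmf_pmf_of_list)
qed

lemma W_set_0: "W_set \<omega> 0 = {}" and L_set_0: "L_set \<omega> 0 = {}"
proof -
  have "(\<lambda>_. 0) \<in> strategies \<omega>"
    by (simp add: strategies_def)
  then show "W_set \<omega> 0 = {}" "L_set \<omega> 0 = {}"
    by (auto simp: W_set_def L_set_def)
qed

lemma W_set_1_iff:
  assumes "v \<in> gw_tree \<omega>"
  shows "v \<in> W_set \<omega> 1 \<longleftrightarrow> (\<exists>i<offspring \<omega> v. edge_into \<omega> (v @ [i]) = Target)"
proof -
  have zero: "(\<lambda>_. 0) \<in> strategies \<omega>"
    by (simp add: strategies_def)
  have upd: "(\<lambda>_. 0)(v := i) \<in> strategies \<omega>" if "i < offspring \<omega> v" for i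
    using that by (simp add: strategies_def)
  show ?thesis
  proof
    assume "v \<in> W_set \<omega> 1"
    then obtain \<sigma> where "\<sigma> \<in> strategies \<omega>" "result_after \<omega> 1 \<sigma> (\<lambda>_. 0) v = Win"
      using zero by (auto simp: W_set_def)
    with assms show "\<exists>i<offspring \<omega> v. edge_into \<omega> (v @ [i]) = Target"
      by (auto simp: strategies_def split: if_splits edge_label.splits)
  next
    assume "\<exists>i<offspring \<omega> v. edge_into \<omega> (v @ [i]) = Target"
    then obtain i where "i < offspring \<omega> v" "edge_into \<omega> (v @ [i]) = Target"
      by blast
    with assms upd[of i] show "v \<in> W_set \<omega> 1"
      by (auto simp: W_set_def intro!: bexI[where x = "(\<lambda>_. 0)(v := i)"])
  qed
qed

lemma L_set_1_iff:
  assumes "v \<in> gw_tree \<omega>"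
  shows "v \<in> L_set \<omega> 1 \<longleftrightarrow> (\<forall>i<offspring \<omega> v. edge_into \<omega> (v @ [i]) = Trap)"
proof -
  have zero: "(\<lambda>_. 0) \<in> strategies \<omega>"
    by (simp add: strategies_def)
  have upd: "(\<lambda>_. 0)(v := i) \<in> strategies \<omega>" if "i < offspring \<omega> v" for i
    using that by (simp add: strategies_def)
  show ?thesis
  proof
    assume "v \<in> L_set \<omega> 1"
    then obtain \<tau> where \<tau>: "\<forall>\<sigma>\<in>strategies \<omega>. result_after \<omega> 1 \<sigma> \<tau> v = Loss"
      by (auto simp: L_set_def)
    show "\<forall>i<offspring \<omega> v. edge_into \<omega> (v @ [i]) = Trap"
    proof (intro allI impI)
      fix i assume "i < offspring \<omega> v"
      with upd[of i] \<tau> show "edge_into \<omega> (v @ [i]) = Trap"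
        by (cases "edge_into \<omega> (v @ [i])") (auto dest!: bspec[where x = "(\<lambda>_. 0)(v := i)"])
    qed
  next
    assume "\<forall>i<offspring \<omega> v. edge_into \<omega> (v @ [i]) = Trap"
    with assms have "\<forall>\<sigma>\<in>strategies \<omega>. result_after \<omega> 1 \<sigma> (\<lambda>_. 0) v = Loss"
      by (auto simp: strategies_def)
    with zero assms show "v \<in> L_set \<omega> 1"
      unfolding L_set_def by blast
  qed
qed

end

theory Submission imports Defs begin

text \<open>
  Let \<open>w\<^sub>n\<close> and \<open>l\<^sub>n\<close> be the probabilities that the first player can force a win, respectively is
  forced to lose, within \<open>n\<close> rounds.  Independence of the subtrees below the children of the root
  turns the game recursion into \<open>x\<^sub>n\<^sub>+\<^sub>1 = g y\<^sub>n\<close> and \<open>y\<^sub>n\<^sub>+\<^sub>1 = g x\<^sub>n\<close> for \<open>x\<^sub>n = p + (1 - p - q) w\<^sub>n\<close> and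
  \<open>y\<^sub>n = (1 - q) - (1 - p - q) l\<^sub>n\<close>, and \<open>y\<^sub>n - x\<^sub>n\<close> is \<open>1 - p - q\<close> times the probability that the
  duration exceeds \<open>n\<close>.  If draws have probability \<open>0\<close>, then \<open>x\<^sub>n\<close> increases and \<open>y\<^sub>n\<close> decreases to
  the common limit \<open>w'\<close>, a fixed point of \<open>g\<close>.  The derivative of \<open>g \<circ> g\<close> there is the square of
  that of \<open>g\<close>, so the hypothesis makes \<open>g\<close> a contraction towards \<open>w'\<close> near \<open>w'\<close>; hence \<open>y\<^sub>n - x\<^sub>n\<close> decays
  geometrically and the tail probabilities of the duration are summable.
\<close>

subsection \<open>The game recursion on a fixed tree\<close>

text \<open>Backward induction replaces the quantifiers over strategies by quantifiers over the
  children of a vertex. Measurability and independence are read off from this form, and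
  \<open>W_set_iff\<close> below shows that it agrees with the strategic one.\<close>

fun wins_within :: "configuration \<Rightarrow> nat \<Rightarrow> vertex \<Rightarrow> bool"
  and loses_within :: "configuration \<Rightarrow> nat \<Rightarrow> vertex \<Rightarrow> bool" where
  "wins_within \<omega> 0 v \<longleftrightarrow> False"
| "wins_within \<omega> (Suc n) v \<longleftrightarrow>
     (\<exists>i<offspring \<omega> v. edge_into \<omega> (v @ [i]) = Target \<or>
        edge_into \<omega> (v @ [i]) = Safe \<and> loses_within \<omega> n (v @ [i]))"
| "loses_within \<omega> 0 v \<longleftrightarrow> False"
| "loses_within \<omega> (Suc n) v \<longleftrightarrow>
     (\<forall>i<offspring \<omega> v. edge_into \<omega> (v @ [i]) = Trap \<or>
        edge_into \<omega> (v @ [i]) = Safe \<and> wins_within \<omega> n (v @ [i]))"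

lemma wins_within_Suc: "wins_within \<omega> n v \<Longrightarrow> wins_within \<omega> (Suc n) v"
  and loses_within_Suc: "loses_within \<omega> n v \<Longrightarrow> loses_within \<omega> (Suc n) v"
proof (induction n arbitrary: v)
  case (Suc n)
  { case 1
    then show ?case
      unfolding wins_within.simps(2)[of \<omega> n v] wins_within.simps(2)[of \<omega> "Suc n" v]
      using Suc.IH(2) by blast }
  { case 2
    then show ?case
      unfolding loses_within.simps(2)[of \<omega> n v] loses_within.simps(2)[of \<omega> "Suc n" v]
      using Suc.IH(1) by blast }
qed auto

lemma wins_within_mono: "m \<le> n \<Longrightarrow> wins_within \<omega> m v \<Longrightarrow> wins_within \<omega> n v"
  by (induction n rule: dec_induct) (auto intro: wins_within_Suc simp del: wins_within.simps(2))

lemma loses_within_mono: "m \<le> n \<Longrightarrow> loses_within \<omega> m v \<Longrightarrow> loses_within \<omega> n v"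
  by (induction n rule: dec_induct) (auto intro: loses_within_Suc simp del: loses_within.simps(2))

text \<open>The chosen move must not depend on the horizon. A move suited to the least horizon at
  which \<open>v\<close> is won suits every larger one, since \<open>loses_within\<close> is
  monotone in the horizon.\<close>

lemma fast_strategy_exists:
  obtains \<sigma> where "\<sigma> \<in> strategies \<omega>"
    and "\<And>n v. wins_within \<omega> (Suc n) v \<Longrightarrow> \<sigma> v < offspring \<omega> v \<and>
           (edge_into \<omega> (v @ [\<sigma> v]) = Target \<or>
            edge_into \<omega> (v @ [\<sigma> v]) = Safe \<and> loses_within \<omega> n (v @ [\<sigma> v]))"
proof -
  have "\<exists>i. (offspring \<omega> v > 0 \<longrightarrow> i < offspring \<omega> v) \<and>
      (\<forall>n. wins_within \<omega> (Suc n) v \<longrightarrow> i < offspring \<omega> v \<and>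
        (edge_into \<omega> (v @ [i]) = Target \<or>
         edge_into \<omega> (v @ [i]) = Safe \<and> loses_within \<omega> n (v @ [i])))" for v
  proof (cases "\<exists>n. wins_within \<omega> (Suc n) v")
    case True
    define m where "m = (LEAST n. wins_within \<omega> (Suc n) v)"
    have "wins_within \<omega> (Suc m) v"
      using True unfolding m_def by (rule LeastI_ex)
    then obtain i where i: "i < offspring \<omega> v" "edge_into \<omega> (v @ [i]) = Target \<or>
         edge_into \<omega> (v @ [i]) = Safe \<and> loses_within \<omega> m (v @ [i])"
      by auto
    have "m \<le> n" if "wins_within \<omega> (Suc n) v" for n
      unfolding m_def using that by (rule Least_le)
    with i show ?thesis
      by (intro exI[of _ i]) (auto intro: loses_within_mono)
  qed auto
  then obtain \<sigma> where \<sigma>: "\<And>v. offspring \<omega> v > 0 \<longrightarrow> \<sigma> v < offspring \<omega> v"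
      "\<And>v n. wins_within \<omega> (Suc n) v \<Longrightarrow> \<sigma> v < offspring \<omega> v \<and>
        (edge_into \<omega> (v @ [\<sigma> v]) = Target \<or>
         edge_into \<omega> (v @ [\<sigma> v]) = Safe \<and> loses_within \<omega> n (v @ [\<sigma> v]))"
    by metis
  show ?thesis
    by (rule that[of \<sigma>]) (use \<sigma> in \<open>auto simp: strategies_def simp del: wins_within.simps(2)\<close>)
qed

text \<open>
  A vertex has finitely many children, so by pigeonhole one and the same move postpones the loss
  beyond every horizon \<open>n\<close> beyond which it can be postponed at all.
\<close>

lemma slow_strategy_exists:
  obtains \<sigma> where "\<sigma> \<in> strategies \<omega>"
    and "\<And>n v. \<not> loses_within \<omega> (Suc n) v \<Longrightarrow> \<sigma> v < offspring \<omega> v \<and>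
           (edge_into \<omega> (v @ [\<sigma> v]) = Target \<or>
            edge_into \<omega> (v @ [\<sigma> v]) = Safe \<and> \<not> wins_within \<omega> n (v @ [\<sigma> v]))"
proof -
  define good where "good v i n \<longleftrightarrow> edge_into \<omega> (v @ [i]) = Target \<or>
            edge_into \<omega> (v @ [i]) = Safe \<and> \<not> wins_within \<omega> n (v @ [i])" for v i n
  have good_mono: "good v i m" if "good v i n" "m \<le> n" for v i m n
    using that wins_within_mono unfolding good_def by blast
  have step: "\<exists>i<offspring \<omega> v. good v i n" if "\<not> loses_within \<omega> (Suc n) v" for v n
    using that edge_label.exhaust unfolding good_def by auto
  have "\<exists>i<offspring \<omega> v. \<forall>n. \<not> loses_within \<omega> (Suc n) v \<longrightarrow> good v i n"
    if pos: "offspring \<omega> v > 0" for v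
  proof (rule ccontr)
    assume "\<not> ?thesis"
    then obtain f where f: "\<And>i. i < offspring \<omega> v \<Longrightarrow> \<not> loses_within \<omega> (Suc (f i)) v \<and> \<not> good v i (f i)"
      by metis
    \<comment> \<open>\<open>f i\<close> is a horizon at which move \<open>i\<close> fails although
      the loss can be postponed. The maximum is attained by some \<open>f i\<close>, so some move
      \<open>j\<close> is still good at \<open>N\<close>, hence also at \<open>f j\<close>, a
      contradiction.\<close>
    define N where "N = Max (f ` {..<offspring \<omega> v})"
    have "N \<in> f ` {..<offspring \<omega> v}"
      unfolding N_def using pos by (intro Max_in) auto
    then have "\<not> loses_within \<omega> (Suc N) v"
      using f by blast
    then obtain j where j: "j < offspring \<omega> v" "good v j N"
      using step by blast
    then have "f j \<le> N"
      unfolding N_def by (intro Max_ge) auto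
    with j f good_mono show False
      by blast
  qed
  then have "\<exists>i. offspring \<omega> v > 0 \<longrightarrow> i < offspring \<omega> v \<and>
      (\<forall>n. \<not> loses_within \<omega> (Suc n) v \<longrightarrow> good v i n)" for v
    by blast
  then obtain \<sigma> where \<sigma>: "\<And>v. offspring \<omega> v > 0 \<Longrightarrow> \<sigma> v < offspring \<omega> v \<and>
      (\<forall>n. \<not> loses_within \<omega> (Suc n) v \<longrightarrow> good v (\<sigma> v) n)"
    by metis
  have "offspring \<omega> v > 0" if "\<not> loses_within \<omega> (Suc n) v" for v n
    using that by auto
  with \<sigma> show ?thesis
    by (intro that[of \<sigma>]) (auto simp: strategies_def good_def simp del: loses_within.simps(2))
qed

text \<open>One strategy serves both roles because the roles swap along every safe edge: the
  induction on the horizon needs the winning and the losing claim together. It stays inside the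
  tree, where strategies of the opponent are constrained to legal moves.\<close>

lemma fast_strategy:
  obtains \<sigma> where "\<sigma> \<in> strategies \<omega>"
    and "\<And>n v \<tau>. v \<in> gw_tree \<omega> \<Longrightarrow> wins_within \<omega> n v \<Longrightarrow> \<tau> \<in> strategies \<omega> \<Longrightarrow>
           result_after \<omega> n \<sigma> \<tau> v = Win"
    and "\<And>n v \<tau>. v \<in> gw_tree \<omega> \<Longrightarrow> loses_within \<omega> n v \<Longrightarrow> \<tau> \<in> strategies \<omega> \<Longrightarrow>
           result_after \<omega> n \<tau> \<sigma> v = Loss"
proof -
  obtain \<sigma> where \<sigma>: "\<sigma> \<in> strategies \<omega>"
    and move: "\<And>n v. wins_within \<omega> (Suc n) v \<Longrightarrow> \<sigma> v < offspring \<omega> v \<and>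
           (edge_into \<omega> (v @ [\<sigma> v]) = Target \<or>
            edge_into \<omega> (v @ [\<sigma> v]) = Safe \<and> loses_within \<omega> n (v @ [\<sigma> v]))"
    using fast_strategy_exists by blast
  have "(wins_within \<omega> n v \<longrightarrow> result_after \<omega> n \<sigma> \<tau> v = Win) \<and>
        (loses_within \<omega> n v \<longrightarrow> result_after \<omega> n \<tau> \<sigma> v = Loss)"
    if "v \<in> gw_tree \<omega>" "\<tau> \<in> strategies \<omega>" for n v \<tau>
    using that
  proof (induction n arbitrary: v)
    case (Suc n)
    have "result_after \<omega> (Suc n) \<sigma> \<tau> v = Win" if "wins_within \<omega> (Suc n) v"
      using move[OF that] Suc.IH[OF gw_tree.child[OF Suc.prems(1), of "\<sigma> v"] Suc.prems(2)] by auto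
    moreover have "result_after \<omega> (Suc n) \<tau> \<sigma> v = Loss" if "loses_within \<omega> (Suc n) v"
    proof (cases "offspring \<omega> v = 0")
      case False
      then have "\<tau> v < offspring \<omega> v"
        using Suc.prems by (auto simp: strategies_def)
      with that Suc.IH[OF gw_tree.child[OF Suc.prems(1), of "\<tau> v"] Suc.prems(2)] show ?thesis
        by auto
    qed simp
    ultimately show ?case
      by blast
  qed simp
  with that \<sigma> show ?thesis
    by blast
qed

text \<open>The counterpart of \<open>fast_strategy\<close>: its owner can be beaten within
  \<open>n\<close> rounds only where the recursion says so, again with a single strategy for all
  \<open>n\<close> and \<open>v\<close>.\<close>

lemma slow_strategy:
  obtains \<sigma> where "\<sigma> \<in> strategies \<omega>"
    and "\<And>n v \<tau>. v \<in> gw_tree \<omega> \<Longrightarrow> \<not> wins_within \<omega> n v \<Longrightarrow> \<tau> \<in> strategies \<omega> \<Longrightarrow>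
           result_after \<omega> n \<tau> \<sigma> v \<noteq> Win"
    and "\<And>n v \<tau>. v \<in> gw_tree \<omega> \<Longrightarrow> \<not> loses_within \<omega> n v \<Longrightarrow> \<tau> \<in> strategies \<omega> \<Longrightarrow>
           result_after \<omega> n \<sigma> \<tau> v \<noteq> Loss"
proof -
  obtain \<sigma> where \<sigma>: "\<sigma> \<in> strategies \<omega>"
    and move: "\<And>n v. \<not> loses_within \<omega> (Suc n) v \<Longrightarrow> \<sigma> v < offspring \<omega> v \<and>
           (edge_into \<omega> (v @ [\<sigma> v]) = Target \<or>
            edge_into \<omega> (v @ [\<sigma> v]) = Safe \<and> \<not> wins_within \<omega> n (v @ [\<sigma> v]))"
    using slow_strategy_exists by blast
  have rev: "reverse_result r = Win \<longleftrightarrow> r = Loss" "reverse_result r = Loss \<longleftrightarrow> r = Win" for r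
    by (cases r; simp)+
  have "(\<not> wins_within \<omega> n v \<longrightarrow> result_after \<omega> n \<tau> \<sigma> v \<noteq> Win) \<and>
        (\<not> loses_within \<omega> n v \<longrightarrow> result_after \<omega> n \<sigma> \<tau> v \<noteq> Loss)"
    if "v \<in> gw_tree \<omega>" "\<tau> \<in> strategies \<omega>" for n v \<tau>
    using that
  proof (induction n arbitrary: v)
    case (Suc n)
    have "result_after \<omega> (Suc n) \<sigma> \<tau> v \<noteq> Loss" if "\<not> loses_within \<omega> (Suc n) v"
    proof -
      have "offspring \<omega> v \<noteq> 0"
        using move[OF that] by auto
      then show ?thesis
        using move[OF that] Suc.IH[OF gw_tree.child[OF Suc.prems(1), of "\<sigma> v"] Suc.prems(2)]
        by (auto simp: rev simp del: wins_within.simps loses_within.simps)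
    qed
    moreover have "result_after \<omega> (Suc n) \<tau> \<sigma> v \<noteq> Win" if "\<not> wins_within \<omega> (Suc n) v"
    proof (cases "offspring \<omega> v = 0")
      case False
      then have "\<tau> v < offspring \<omega> v"
        using Suc.prems by (auto simp: strategies_def)
      then have "edge_into \<omega> (v @ [\<tau> v]) \<noteq> Target"
          "edge_into \<omega> (v @ [\<tau> v]) = Safe \<Longrightarrow> \<not> loses_within \<omega> n (v @ [\<tau> v])"
        using that by auto
      with Suc.IH[OF gw_tree.child[OF Suc.prems(1), of "\<tau> v"] Suc.prems(2)] False \<open>\<tau> v < _\<close>
      show ?thesis
        by (cases "edge_into \<omega> (v @ [\<tau> v])") (simp_all add: rev)
    qed simp
    ultimately show ?case
      by blast
  qed simp
  with that \<sigma> show ?thesis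
    by blast
qed

text \<open>The fast strategy is a witness when the recursion succeeds; when it fails, the slow
  strategy of the opponent refutes every candidate. In \<open>won_by_first\<close> the number of
  rounds may depend on the opponent, so it matters that one slow strategy withstands all horizons at
  once.\<close>

lemma W_set_iff: "v \<in> W_set \<omega> n \<longleftrightarrow> v \<in> gw_tree \<omega> \<and> wins_within \<omega> n v"
  and won_by_first_iff: "won_by_first \<omega> \<longleftrightarrow> (\<exists>n. wins_within \<omega> n [])"
  and L_set_iff: "v \<in> L_set \<omega> n \<longleftrightarrow> v \<in> gw_tree \<omega> \<and> loses_within \<omega> n v"
  and lost_by_first_iff: "lost_by_first \<omega> \<longleftrightarrow> (\<exists>n. loses_within \<omega> n [])"
proof -
  obtain \<sigma> where \<sigma>: "\<sigma> \<in> strategies \<omega>"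
    "\<And>n v \<tau>. v \<in> gw_tree \<omega> \<Longrightarrow> wins_within \<omega> n v \<Longrightarrow> \<tau> \<in> strategies \<omega> \<Longrightarrow>
           result_after \<omega> n \<sigma> \<tau> v = Win"
    "\<And>n v \<tau>. v \<in> gw_tree \<omega> \<Longrightarrow> loses_within \<omega> n v \<Longrightarrow> \<tau> \<in> strategies \<omega> \<Longrightarrow>
           result_after \<omega> n \<tau> \<sigma> v = Loss"
    by (rule fast_strategy) blast
  obtain \<rho> where \<rho>: "\<rho> \<in> strategies \<omega>"
    "\<And>n v \<tau>. v \<in> gw_tree \<omega> \<Longrightarrow> \<not> wins_within \<omega> n v \<Longrightarrow> \<tau> \<in> strategies \<omega> \<Longrightarrow>
           result_after \<omega> n \<tau> \<rho> v \<noteq> Win"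
    "\<And>n v \<tau>. v \<in> gw_tree \<omega> \<Longrightarrow> \<not> loses_within \<omega> n v \<Longrightarrow> \<tau> \<in> strategies \<omega> \<Longrightarrow>
           result_after \<omega> n \<rho> \<tau> v \<noteq> Loss"
    by (rule slow_strategy) blast
  note root = gw_tree.root[of \<omega>]
  show "v \<in> W_set \<omega> n \<longleftrightarrow> v \<in> gw_tree \<omega> \<and> wins_within \<omega> n v"
    unfolding W_set_def using \<sigma>(1,2) \<rho>(1,2) by blast
  show "won_by_first \<omega> \<longleftrightarrow> (\<exists>n. wins_within \<omega> n [])"
    unfolding won_by_first_def using \<sigma>(1,2) \<rho>(1,2) root by blast
  show "v \<in> L_set \<omega> n \<longleftrightarrow> v \<in> gw_tree \<omega> \<and> loses_within \<omega> n v"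
    unfolding L_set_def using \<sigma>(1,3) \<rho>(1,3) by blast
  show "lost_by_first \<omega> \<longleftrightarrow> (\<exists>n. loses_within \<omega> n [])"
    unfolding lost_by_first_def using \<sigma>(1,3) \<rho>(1,3) root by blast
qed

lemma not_wins_and_loses_within: "wins_within \<omega> n v \<Longrightarrow> loses_within \<omega> n v \<Longrightarrow> False"
proof (induction n arbitrary: v)
  case (Suc n)
  then show ?case by fastforce
qed simp

text \<open>The tail-sum bound: the duration is at most the number of horizons at which the game is
  still undecided, and this number is infinite if it is never decided.\<close>

lemma duration_le_suminf:
  "ennreal_of_enat (duration \<omega>) \<le> (\<Sum>n. indicator {\<omega>. \<not> wins_within \<omega> n [] \<and> \<not> loses_within \<omega> n []} \<omega>)"
proof (cases "\<exists>n. wins_within \<omega> n [] \<or> loses_within \<omega> n []")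
  case True
  define N where "N = (LEAST n. wins_within \<omega> n [] \<or> loses_within \<omega> n [])"
  have N: "wins_within \<omega> N [] \<or> loses_within \<omega> N []"
    using True unfolding N_def by (rule LeastI_ex)
  have less: "\<not> wins_within \<omega> n [] \<and> \<not> loses_within \<omega> n []" if "n < N" for n
    using not_less_Least[OF that[unfolded N_def]] by blast
  have "duration \<omega> \<le> enat N"
    unfolding duration_def using N by (intro INF_lower) (auto simp: W_set_iff L_set_iff gw_tree.root)
  then have "ennreal_of_enat (duration \<omega>) \<le> ennreal_of_enat (enat N)"
    by (simp del: ennreal_of_enat_enat)
  also have "\<dots> = (\<Sum>n<N. indicator {\<omega>. \<not> wins_within \<omega> n [] \<and> \<not> loses_within \<omega> n []} \<omega>)"
    using less by simp
  also have "\<dots> \<le> (\<Sum>n. indicator {\<omega>. \<not> wins_within \<omega> n [] \<and> \<not> loses_within \<omega> n []} \<omega>)"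
    by (intro sum_le_suminf) auto
  finally show ?thesis .
next
  case False
  then have "(\<Sum>n. indicator {\<omega>. \<not> wins_within \<omega> n [] \<and> \<not> loses_within \<omega> n []} \<omega>) = (\<Sum>n. 1 :: ennreal)"
    by simp
  also have "\<dots> = \<infinity>"
    by (subst suminf_eq_SUP) (simp add: ennreal_SUP_of_nat_eq_top)
  finally show ?thesis
    by simp
qed

subsection \<open>Recursion for the winning and losing probabilities\<close>

text \<open>The label of the edge into child \<open>i\<close> is kept, as the label of the word
  \<open>[]\<close> of the shifted configuration. Thus everything that decides the value of a move
  to \<open>i\<close> is a function of one shifted configuration.\<close>

definition subtree :: "nat \<Rightarrow> configuration \<Rightarrow> configuration" where
  "subtree i \<omega> = (\<lambda>v. \<omega> (i # v))"

lemma wins_within_Cons: "wins_within \<omega> n (i # v) \<longleftrightarrow> wins_within (subtree i \<omega>) n v"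
  and loses_within_Cons: "loses_within \<omega> n (i # v) \<longleftrightarrow> loses_within (subtree i \<omega>) n v"
  by (induction n arbitrary: v) (simp_all add: offspring_def edge_into_def subtree_def)

lemma loses_within_root_Suc:
  "loses_within \<omega> (Suc n) [] \<longleftrightarrow>
     (\<forall>i<offspring \<omega> []. edge_into (subtree i \<omega>) [] = Trap \<or>
        edge_into (subtree i \<omega>) [] = Safe \<and> wins_within (subtree i \<omega>) n [])"
  by (simp add: wins_within_Cons) (simp add: edge_into_def subtree_def)

text \<open>Negation turns winning into a condition that every child satisfies one and the same
  predicate; the generating function gives the probability of exactly such events.\<close>

lemma not_wins_within_root_Suc:
  "\<not> wins_within \<omega> (Suc n) [] \<longleftrightarrow>
     (\<forall>i<offspring \<omega> []. edge_into (subtree i \<omega>) [] = Trap \<or>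
        edge_into (subtree i \<omega>) [] = Safe \<and> \<not> loses_within (subtree i \<omega>) n [])"
proof -
  have label: "\<not> (c = Target \<or> c = Safe \<and> P) \<longleftrightarrow> c = Trap \<or> c = Safe \<and> \<not> P" for c P
    by (cases c) auto
  have edge: "edge_into (subtree i \<omega>) [] = edge_into \<omega> [i]" for i
    by (simp add: edge_into_def subtree_def)
  show ?thesis
    unfolding wins_within.simps append_Nil loses_within_Cons edge label[symmetric] by blast
qed

lemma summable_pgf: "\<bar>x\<bar> \<le> 1 \<Longrightarrow> summable (\<lambda>m. x ^ m * pmf chi m)"
proof (rule summable_comparison_test)
  assume "\<bar>x\<bar> \<le> 1"
  then have "norm (x ^ m * pmf chi m) \<le> pmf chi m" for m
    by (simp add: abs_mult power_abs mult_left_le_one_le power_le_one)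
  then show "\<exists>N. \<forall>n\<ge>N. norm (x ^ n * pmf chi n) \<le> pmf chi n"
    by blast
  show "summable (pmf chi)"
    using pmf_abs_summable[of chi UNIV] abs_summable_on_nat_iff'[of "pmf chi"] by simp
qed

section \<open>The product measure, its shifts and independence of subtrees\<close>

locale percolation_parameters =
  fixes chi :: "nat pmf" and p q :: real
  assumes p_nonneg: "0 \<le> p" and q_nonneg: "0 \<le> q" and safe_pos: "p + q < 1"
begin

abbreviation "vertex_law \<equiv> measure_pmf (pair_pmf chi (label_pmf p q))"

abbreviation "game_law \<equiv> percolation_game chi p q"

lemma space_game_law [simp]: "space game_law = UNIV"
  by (simp add: percolation_game_def space_PiM)

sublocale vertex: product_prob_space "\<lambda>_::vertex. vertex_law" UNIV ..

sublocale prob_space game_law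
  unfolding percolation_game_def by (rule prob_space_PiM) (rule measure_pmf.prob_space_axioms)

lemma events_Collect: "Measurable.pred game_law P \<Longrightarrow> {\<omega>. P \<omega>} \<in> events"
  by (simp add: pred_def)

lemma coordinate_measurable:
  assumes "v \<in> I"
  shows "(\<lambda>\<omega>. \<omega> v) \<in> measurable (PiM I (\<lambda>_. vertex_law)) (count_space UNIV)"
proof -
  have "(\<lambda>\<omega>. \<omega> v) \<in> measurable (PiM I (\<lambda>_. vertex_law)) vertex_law"
    using assms by (rule measurable_component_singleton)
  then show ?thesis
    by simp
qed

lemma vertex_data_measurable [measurable]:
  "(\<lambda>\<omega>. \<omega> v) \<in> measurable game_law (count_space UNIV)"
  unfolding percolation_game_def by (rule coordinate_measurable) simp

lemma offspring_measurable [measurable]: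
  "(\<lambda>\<omega>. offspring \<omega> v) \<in> measurable game_law (count_space UNIV)"
  unfolding offspring_def by (rule measurable_compose[OF vertex_data_measurable]) simp

lemma edge_into_measurable [measurable]:
  "(\<lambda>\<omega>. edge_into \<omega> v) \<in> measurable game_law (count_space UNIV)"
  unfolding edge_into_def by (rule measurable_compose[OF vertex_data_measurable]) simp

lemma wins_within_measurable [measurable]: "Measurable.pred game_law (\<lambda>\<omega>. wins_within \<omega> n v)"
  and loses_within_measurable [measurable]: "Measurable.pred game_law (\<lambda>\<omega>. loses_within \<omega> n v)"
proof (induction n arbitrary: v)
  case (Suc n)
  note [measurable] = Suc.IH
  { case 1 show ?case by (simp, measurable) }
  { case 2 show ?case by (simp, measurable) }
qed simp_all

lemma subtree_measurable [measurable]: "subtree i \<in> measurable game_law game_law"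
  unfolding subtree_def[abs_def] percolation_game_def
  by (intro measurable_PiM_single') (auto simp: space_PiM intro: coordinate_measurable)

text \<open>Prefixing \<open>i\<close> is injective on words, so reindexing along it preserves the
  law of an i.i.d. family.\<close>

lemma distr_subtree: "distr game_law game_law (subtree i) = game_law"
proof -
  have "distr game_law game_law (\<lambda>\<omega>. \<lambda>v\<in>UNIV. \<omega> (i # v)) = game_law"
    unfolding percolation_game_def
    by (rule distr_PiM_reindex) (auto intro: prob_space_measure_pmf)
  then show ?thesis
    by (simp add: subtree_def[abs_def] restrict_def)
qed

lemma prob_subtree:
  assumes [measurable]: "Measurable.pred game_law Q"
  shows "prob {\<omega>. Q (subtree i \<omega>)} = prob {\<omega>. Q \<omega>}"
proof -
  have "prob {\<omega>. Q \<omega>} = measure (distr game_law game_law (subtree i)) {\<omega>. Q \<omega>}"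
    by (simp add: distr_subtree)
  also have "\<dots> = prob {\<omega>. Q (subtree i \<omega>)}"
    using assms by (subst measure_distr) (auto simp: pred_def vimage_def)
  finally show ?thesis ..
qed

lemma prob_root: "prob {\<omega>. \<omega> [] \<in> B} = measure vertex_law B"
proof -
  have "distr game_law vertex_law (\<lambda>\<omega>. \<omega> []) = vertex_law"
    unfolding percolation_game_def by (rule vertex.PiM_component) auto
  then have "measure vertex_law B = measure (distr game_law vertex_law (\<lambda>\<omega>. \<omega> [])) B"
    by simp
  also have "\<dots> = prob {\<omega>. \<omega> [] \<in> B}"
    by (subst measure_distr) (auto simp: vimage_def)
  finally show ?thesis ..
qed

lemma indep_vertices: "indep_vars (\<lambda>_. vertex_law) (\<lambda>v \<omega>. \<omega> v) UNIV"
proof -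
  have component: "distr game_law vertex_law (\<lambda>\<omega>. \<omega> v) = vertex_law" for v
    unfolding percolation_game_def by (rule vertex.PiM_component) auto
  have "distr game_law (PiM UNIV (\<lambda>_. vertex_law)) (\<lambda>\<omega>. \<lambda>v\<in>UNIV. \<omega> v) = game_law"
    unfolding restrict_UNIV percolation_game_def[symmetric] by (rule distr_id)
  then show ?thesis
    by (subst indep_vars_iff_distr_eq_PiM)
       (auto simp: component[unfolded percolation_game_def] percolation_game_def
          intro!: coordinate_measurable)
qed

text \<open>The root and the words below distinct children occupy disjoint sets of coordinates,
  hence are independent, and each shifted configuration has the law of the whole.\<close>

lemma prob_root_subtrees:
  assumes Q [measurable]: "Measurable.pred game_law Q"
  shows "prob {\<omega>. \<omega> [] \<in> B \<and> (\<forall>i<k. Q (subtree i \<omega>))} = measure vertex_law B * prob {\<omega>. Q \<omega>} ^ k"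
proof -
  \<comment> \<open>Block \<open>0\<close> is the root and block \<open>Suc i\<close> consists of
    the words below child \<open>i\<close>, so the blocks in \<open>{..k}\<close> are the root and
    its first \<open>k\<close> children.\<close>
  define K :: "nat \<Rightarrow> vertex set" where "K j = (case j of 0 \<Rightarrow> {[]} | Suc i \<Rightarrow> range ((#) i))" for j
  define X where "X j \<omega> = restrict \<omega> (K j)" for j and \<omega> :: configuration
  define A where "A j = {f \<in> space (PiM (K j) (\<lambda>_. vertex_law)).
      case j of 0 \<Rightarrow> f [] \<in> B | Suc i \<Rightarrow> Q (\<lambda>v. f (i # v))}" for j
  have indep: "indep_vars (\<lambda>j. PiM (K j) (\<lambda>_. vertex_law)) X UNIV"
    unfolding X_def
    by (rule indep_vars_restrict[OF indep_vertices])
       (auto simp: disjoint_family_on_def K_def split: nat.splits)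
  have A: "A j \<in> sets (PiM (K j) (\<lambda>_. vertex_law))" for j
  proof (cases j)
    case 0
    have "(\<lambda>f. f []) \<in> measurable (PiM (K j) (\<lambda>_. vertex_law)) vertex_law"
      by (rule measurable_component_singleton) (simp add: K_def 0)
    then have "(\<lambda>f. f []) -` B \<inter> space (PiM (K j) (\<lambda>_. vertex_law)) \<in> sets (PiM (K j) (\<lambda>_. vertex_law))"
      by (rule measurable_sets) simp
    also have "(\<lambda>f. f []) -` B \<inter> space (PiM (K j) (\<lambda>_. vertex_law)) = A j"
      by (auto simp: A_def 0)
    finally show ?thesis .
  next
    case (Suc i)
    have "(\<lambda>f v. f (i # v)) \<in> measurable (PiM (K j) (\<lambda>_. vertex_law)) game_law"
      unfolding percolation_game_def
      by (intro measurable_PiM_single')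
         (auto simp: K_def Suc space_PiM intro!: coordinate_measurable)
    then have "Measurable.pred (PiM (K j) (\<lambda>_. vertex_law)) (\<lambda>f. Q (\<lambda>v. f (i # v)))"
      using Q by (rule measurable_compose)
    then show ?thesis
      by (simp add: A_def Suc pred_def)
  qed
  have vim0: "X 0 -` A 0 = {\<omega>. \<omega> [] \<in> B}"
    by (auto simp: X_def A_def K_def space_PiM)
  have vimS: "X (Suc i) -` A (Suc i) = {\<omega>. Q (subtree i \<omega>)}" for i
    by (auto simp: X_def A_def K_def space_PiM subtree_def)
  have "{\<omega>. \<omega> [] \<in> B \<and> (\<forall>i<k. Q (subtree i \<omega>))} = (\<Inter>j\<in>{..k}. X j -` A j)"
    unfolding lessThan_Suc_atMost[symmetric] lessThan_Suc_eq_insert_0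
    by (auto simp: vim0 vimS)
  also have "prob \<dots> = (\<Prod>j\<in>{..k}. prob (X j -` A j))"
    using indep_varsD[OF indep, of "{..k}" A] A by auto
  also have "\<dots> = measure vertex_law B * prob {\<omega>. Q \<omega>} ^ k"
    unfolding prod.atMost_shift vim0 vimS by (simp add: prob_root prob_subtree[OF Q])
  finally show ?thesis .
qed

lemma prob_label_all_subtrees:
  assumes Q [measurable]: "Measurable.pred game_law Q"
  shows "prob {\<omega>. edge_into \<omega> [] = c \<and> (\<forall>i<offspring \<omega> []. Q (subtree i \<omega>))} =
         pmf (label_pmf p q) c * pgf chi (prob {\<omega>. Q \<omega>})"
proof -
  \<comment> \<open>Fixing the number of children makes the range of the quantifier deterministic;
    summation over \<open>k\<close> then produces the power series.\<close>
  define E where "E k = {\<omega>. \<omega> [] \<in> {(k, c)} \<and> (\<forall>i<k. Q (subtree i \<omega>))}" for k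
  have [measurable]: "Measurable.pred game_law (\<lambda>\<omega>. Q (subtree i \<omega>))" for i
    using subtree_measurable Q by (rule measurable_compose)
  have "E k \<in> sets game_law" for k
  proof -
    have "Measurable.pred game_law (\<lambda>\<omega>. \<omega> [] = (k, c) \<and> (\<forall>i<k. Q (subtree i \<omega>)))"
      by measurable
    then show ?thesis
      by (simp add: pred_def E_def)
  qed
  moreover have "disjoint_family E"
    by (auto simp: disjoint_family_on_def E_def)
  ultimately have "(\<lambda>k. prob (E k)) sums prob (\<Union>k. E k)"
    by (intro finite_measure_UNION) auto
  moreover have "(\<Union>k. E k) = {\<omega>. edge_into \<omega> [] = c \<and> (\<forall>i<offspring \<omega> []. Q (subtree i \<omega>))}"
    by (auto simp: E_def edge_into_def offspring_def prod_eq_iff)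
  ultimately have "(\<lambda>k. prob (E k)) sums
      prob {\<omega>. edge_into \<omega> [] = c \<and> (\<forall>i<offspring \<omega> []. Q (subtree i \<omega>))}"
    by simp
  moreover have "prob (E k) = pmf (label_pmf p q) c * (prob {\<omega>. Q \<omega>} ^ k * pmf chi k)" for k
    unfolding E_def prob_root_subtrees[OF Q] measure_pmf_single by (simp add: pmf_pair)
  moreover have "(\<lambda>k. pmf (label_pmf p q) c * (prob {\<omega>. Q \<omega>} ^ k * pmf chi k)) sums
      (pmf (label_pmf p q) c * pgf chi (prob {\<omega>. Q \<omega>}))"
    unfolding pgf_def by (intro sums_mult summable_sums summable_pgf) auto
  ultimately show ?thesis
    by (simp only: sums_unique2)
qed

lemma label_probs:
  "pmf (label_pmf p q) Trap = p" "pmf (label_pmf p q) Target = q"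
  "pmf (label_pmf p q) Safe = 1 - p - q"
  using p_nonneg q_nonneg safe_pos by (simp_all add: pmf_label_pmf)

lemma prob_all_subtrees:
  assumes Q [measurable]: "Measurable.pred game_law Q"
  shows "prob {\<omega>. \<forall>i<offspring \<omega> []. Q (subtree i \<omega>)} = pgf chi (prob {\<omega>. Q \<omega>})"
proof -
  define E where "E c = {\<omega>. edge_into \<omega> [] = c \<and> (\<forall>i<offspring \<omega> []. Q (subtree i \<omega>))}" for c
  have [measurable]: "Measurable.pred game_law (\<lambda>\<omega>. Q (subtree i \<omega>))" for i
    using subtree_measurable Q by (rule measurable_compose)
  have meas: "E c \<in> sets game_law" for c
  proof -
    have "Measurable.pred game_law (\<lambda>\<omega>. edge_into \<omega> [] = c \<and> (\<forall>i<offspring \<omega> []. Q (subtree i \<omega>)))"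
      by measurable
    then show ?thesis
      by (simp add: pred_def E_def)
  qed
  have "{\<omega>. \<forall>i<offspring \<omega> []. Q (subtree i \<omega>)} = (\<Union>c\<in>{Trap, Target, Safe}. E c)"
    using edge_label.exhaust by (auto simp: E_def)
  also have "prob \<dots> = (\<Sum>c\<in>{Trap, Target, Safe}. prob (E c))"
    using meas by (intro finite_measure_finite_Union) (auto simp: disjoint_family_on_def E_def)
  also have "\<dots> = pgf chi (prob {\<omega>. Q \<omega>})"
    by (simp add: E_def prob_label_all_subtrees[OF Q] label_probs algebra_simps)
  finally show ?thesis .
qed

section \<open>The one-step recursion for the probabilities\<close>

definition "wins_prob n = prob {\<omega>. wins_within \<omega> n []}"

definition "loses_prob n = prob {\<omega>. loses_within \<omega> n []}"

lemma prob_trap: "prob {\<omega>. edge_into \<omega> [] = Trap} = p"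
  and prob_safe: "prob {\<omega>. edge_into \<omega> [] = Safe} = 1 - p - q"
proof -
  have "prob {\<omega>. edge_into \<omega> [] = c} = pmf (label_pmf p q) c" for c
  proof -
    have "prob {\<omega>. edge_into \<omega> [] = c} = measure vertex_law (snd -` {c})"
      unfolding prob_root[symmetric] by (simp add: edge_into_def)
    also have "\<dots> = measure (map_pmf snd (pair_pmf chi (label_pmf p q))) {c}"
      by (simp only: measure_map_pmf)
    finally show ?thesis
      by (simp add: map_snd_pair_pmf measure_pmf_single)
  qed
  then show "prob {\<omega>. edge_into \<omega> [] = Trap} = p" "prob {\<omega>. edge_into \<omega> [] = Safe} = 1 - p - q"
    by (simp_all add: label_probs)
qed

text \<open>
  The label of the edge into the root plays no role in the game at the root, so it is independent
  of its outcome; for a subtree it is the label of the edge into that subtree.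
\<close>

lemma prob_safe_loses_within:
  "prob {\<omega>. edge_into \<omega> [] = Safe \<and> loses_within \<omega> n []} = (1 - p - q) * loses_prob n"
proof (cases n)
  case (Suc m)
  have "Measurable.pred game_law (\<lambda>\<omega>. edge_into \<omega> [] = Trap \<or>
      edge_into \<omega> [] = Safe \<and> wins_within \<omega> m [])"
    by measurable
  from prob_label_all_subtrees[OF this] prob_all_subtrees[OF this] show ?thesis
    unfolding loses_prob_def Suc loses_within_root_Suc by (simp add: label_probs)
qed (simp add: loses_prob_def)

lemma prob_safe_not_wins_within:
  "prob {\<omega>. edge_into \<omega> [] = Safe \<and> \<not> wins_within \<omega> n []} = (1 - p - q) * (1 - wins_prob n)"
proof (cases n)
  case 0
  then show ?thesis by (simp add: wins_prob_def prob_safe)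
next
  case (Suc m)
  have compl: "1 - wins_prob n = prob {\<omega>. \<not> wins_within \<omega> n []}"
    using prob_neg[of "\<lambda>\<omega>. wins_within \<omega> n []"] events_Collect[OF wins_within_measurable]
    by (simp add: wins_prob_def)
  have "Measurable.pred game_law (\<lambda>\<omega>. edge_into \<omega> [] = Trap \<or>
      edge_into \<omega> [] = Safe \<and> \<not> loses_within \<omega> m [])"
    by measurable
  from prob_label_all_subtrees[OF this] prob_all_subtrees[OF this] show ?thesis
    unfolding Suc compl[unfolded Suc] not_wins_within_root_Suc by (simp add: label_probs)
qed

lemma loses_prob_Suc: "loses_prob (Suc n) = pgf chi (p + (1 - p - q) * wins_prob n)"
proof -
  \<comment> \<open>Independence from the root label was obtained for not winning, which is a
    condition on all children; the event of a safe edge into a won vertex is therefore taken as a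
    difference.\<close>
  have "prob {\<omega>. edge_into \<omega> [] = Trap \<or> edge_into \<omega> [] = Safe \<and> wins_within \<omega> n []} =
      prob ({\<omega>. edge_into \<omega> [] = Trap} \<union>
        ({\<omega>. edge_into \<omega> [] = Safe} - {\<omega>. edge_into \<omega> [] = Safe \<and> \<not> wins_within \<omega> n []}))"
    by (rule arg_cong[where f = prob]) auto
  also have "\<dots> = p + (prob {\<omega>. edge_into \<omega> [] = Safe} -
      prob {\<omega>. edge_into \<omega> [] = Safe \<and> \<not> wins_within \<omega> n []})"
    by (subst finite_measure_Union, (intro sets.Diff events_Collect; measurable)+, force,
        subst finite_measure_Diff, (intro events_Collect; measurable)+)
       (auto simp: prob_trap)
  also have "\<dots> = p + (1 - p - q) * wins_prob n"
    by (simp add: prob_safe prob_safe_not_wins_within algebra_simps)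
  finally have eq: "prob {\<omega>. edge_into \<omega> [] = Trap \<or> edge_into \<omega> [] = Safe \<and> wins_within \<omega> n []} =
      p + (1 - p - q) * wins_prob n" .
  have "Measurable.pred game_law (\<lambda>\<omega>. edge_into \<omega> [] = Trap \<or>
      edge_into \<omega> [] = Safe \<and> wins_within \<omega> n [])"
    by measurable
  from prob_all_subtrees[OF this] show ?thesis
    unfolding loses_prob_def loses_within_root_Suc eq .
qed

lemma wins_prob_Suc: "wins_prob (Suc n) = 1 - pgf chi (1 - q - (1 - p - q) * loses_prob n)"
proof -
  have "prob {\<omega>. edge_into \<omega> [] = Trap \<or> edge_into \<omega> [] = Safe \<and> \<not> loses_within \<omega> n []} =
      prob ({\<omega>. edge_into \<omega> [] = Trap} \<union>
        ({\<omega>. edge_into \<omega> [] = Safe} - {\<omega>. edge_into \<omega> [] = Safe \<and> loses_within \<omega> n []}))"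
    by (rule arg_cong[where f = prob]) auto
  also have "\<dots> = p + (prob {\<omega>. edge_into \<omega> [] = Safe} -
      prob {\<omega>. edge_into \<omega> [] = Safe \<and> loses_within \<omega> n []})"
    by (subst finite_measure_Union, (intro sets.Diff events_Collect; measurable)+, force,
        subst finite_measure_Diff, (intro events_Collect; measurable)+)
       (auto simp: prob_trap)
  also have "\<dots> = 1 - q - (1 - p - q) * loses_prob n"
    by (simp add: prob_safe prob_safe_loses_within algebra_simps)
  finally have eq: "prob {\<omega>. edge_into \<omega> [] = Trap \<or> edge_into \<omega> [] = Safe \<and> \<not> loses_within \<omega> n []} =
      1 - q - (1 - p - q) * loses_prob n" .
  have "Measurable.pred game_law (\<lambda>\<omega>. edge_into \<omega> [] = Trap \<or>
      edge_into \<omega> [] = Safe \<and> \<not> loses_within \<omega> n [])"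
    by measurable
  from prob_all_subtrees[OF this] have "prob {\<omega>. \<not> wins_within \<omega> (Suc n) []} =
      pgf chi (1 - q - (1 - p - q) * loses_prob n)"
    unfolding not_wins_within_root_Suc eq .
  then show ?thesis
    using prob_neg[of "\<lambda>\<omega>. wins_within \<omega> (Suc n) []"] events_Collect[OF wins_within_measurable]
    by (simp add: wins_prob_def del: wins_within.simps)
qed

end

subsection \<open>Convergence to the fixed point\<close>

lemma pmf_nat_sums_1: "pmf (chi :: nat pmf) sums 1"
proof -
  have "(\<lambda>m. measure_pmf.prob chi {m}) sums measure_pmf.prob chi (\<Union>m. {m})"
    by (intro measure_pmf.finite_measure_UNION) (auto simp: disjoint_family_on_def)
  then show ?thesis
    by (simp add: measure_pmf_single UN_singleton)
qed

lemma pgf_nonneg: "0 \<le> x \<Longrightarrow> x \<le> 1 \<Longrightarrow> 0 \<le> pgf chi x"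
  unfolding pgf_def by (intro suminf_nonneg summable_pgf) auto

lemma pgf_le_1: "0 \<le> x \<Longrightarrow> x \<le> 1 \<Longrightarrow> pgf chi x \<le> 1"
  using suminf_le[of "\<lambda>m. x ^ m * pmf chi m" "pmf chi"] pmf_nat_sums_1[of chi] summable_pgf[of x chi]
  by (simp add: pgf_def sums_iff mult_left_le_one_le power_le_one)

lemma pgf_pos: "0 < x \<Longrightarrow> x \<le> 1 \<Longrightarrow> 0 < pgf chi x"
proof -
  assume x: "0 < x" "x \<le> 1"
  obtain m where "m \<in> set_pmf chi"
    using set_pmf_not_empty[of chi] by blast
  with x show "0 < pgf chi x"
    unfolding pgf_def by (intro suminf_pos2[of _ m] summable_pgf) (auto simp: pmf_positive)
qed

text \<open>Some \<open>m > 0\<close> carries mass, and its term alone makes the series of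
  differences \<open>pmf chi m - x ^ m * pmf chi m\<close> strictly positive.\<close>

lemma pgf_less_1:
  assumes x: "0 \<le> x" "x < 1" and "pmf chi 0 < 1"
  shows "pgf chi x < 1"
proof -
  obtain m where m: "m \<in> set_pmf chi" "m \<noteq> 0"
  proof -
    have "\<not> set_pmf chi \<subseteq> {0}"
      using assms(3) by (auto simp: set_pmf_subset_singleton)
    then show ?thesis
      using that by auto
  qed
  have "(\<lambda>m. pmf chi m - x ^ m * pmf chi m) sums (1 - pgf chi x)"
    unfolding pgf_def using x by (intro sums_diff pmf_nat_sums_1 summable_sums summable_pgf) auto
  moreover have "0 < (\<Sum>m. pmf chi m - x ^ m * pmf chi m)"
  proof (rule suminf_pos2)
    show "summable (\<lambda>m. pmf chi m - x ^ m * pmf chi m)"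
      using calculation by (rule sums_summable)
    show "0 \<le> pmf chi n - x ^ n * pmf chi n" for n
      using x by (simp add: mult_left_le_one_le power_le_one)
    have "x ^ m < 1"
      using x m(2) by (simp add: power_less_one_iff)
    then show "0 < pmf chi m - x ^ m * pmf chi m"
      using pmf_positive[OF m(1)] by simp
  qed
  ultimately show ?thesis
    by (simp add: sums_iff)
qed

lemma pgf_differentiable:
  assumes "\<bar>x\<bar> < 1"
  shows "pgf chi field_differentiable at x"
proof -
  have "summable (\<lambda>m. pmf chi m * 1 ^ m)"
    using pmf_nat_sums_1[of chi] by (simp add: sums_iff)
  then have "((\<lambda>x. \<Sum>m. pmf chi m * x ^ m) has_field_derivative (\<Sum>m. diffs (pmf chi) m * x ^ m)) (at x)"
    using assms by (intro termdiffs_strong[where K = 1]) auto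
  then show ?thesis
    unfolding pgf_def[abs_def] field_differentiable_def by (auto simp: mult.commute)
qed

text \<open>The difference quotient at \<open>a\<close> tends to \<open>D\<close>, so near
  \<open>a\<close> it stays below \<open>c\<close> in absolute value. The estimate compares points
  with \<open>a\<close> only, which suffices for iterates approaching a fixed point.\<close>

lemma DERIV_eventually_abs_le:
  fixes f :: "real \<Rightarrow> real"
  assumes "(f has_field_derivative D) (at a)" and "\<bar>D\<bar> < c"
  shows "\<forall>\<^sub>F z in nhds a. \<bar>f z - f a\<bar> \<le> c * \<bar>z - a\<bar>"
proof -
  have "((\<lambda>z. (f z - f a) / (z - a)) \<longlongrightarrow> D) (at a)"
    using assms(1) by (simp add: has_field_derivative_iff)
  then have "\<forall>\<^sub>F z in at a. \<bar>(f z - f a) / (z - a)\<bar> < c"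
    by (intro order_tendstoD(2)[OF tendsto_rabs assms(2)])
  then have "\<forall>\<^sub>F z in nhds a. z \<noteq> a \<longrightarrow> \<bar>(f z - f a) / (z - a)\<bar> < c"
    by (simp add: eventually_at_filter)
  then show ?thesis
  proof eventually_elim
    case (elim z)
    show ?case
    proof (cases "z = a")
      case False
      with elim have "\<bar>f z - f a\<bar> / \<bar>z - a\<bar> < c"
        by (simp only: abs_divide simp_thms)
      with False show ?thesis
        by (simp only: pos_divide_less_eq zero_less_abs_iff right_minus_eq not_False_eq_True less_imp_le)
    qed simp
  qed
qed

section \<open>Monotone limits and the tail sum of the duration\<close>

context percolation_parameters
begin

lemma wins_prob_mono: "m \<le> n \<Longrightarrow> wins_prob m \<le> wins_prob n"
  unfolding wins_prob_def using wins_within_mono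
  by (intro finite_measure_mono events_Collect[OF wins_within_measurable]) blast

lemma loses_prob_mono: "m \<le> n \<Longrightarrow> loses_prob m \<le> loses_prob n"
  unfolding loses_prob_def using loses_within_mono
  by (intro finite_measure_mono events_Collect[OF loses_within_measurable]) blast

lemma wins_prob_tendsto: "wins_prob \<longlonglongrightarrow> win_prob chi p q"
proof -
  have "(\<lambda>n. prob {\<omega>. wins_within \<omega> n []}) \<longlonglongrightarrow> prob (\<Union>n. {\<omega>. wins_within \<omega> n []})"
    using events_Collect[OF wins_within_measurable] wins_within_mono
    by (intro finite_Lim_measure_incseq) (auto simp: incseq_def)
  moreover have "(\<Union>n. {\<omega>. wins_within \<omega> n []}) = {\<omega>. won_by_first \<omega>}"
    by (auto simp: won_by_first_iff)
  ultimately show ?thesis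
    by (simp add: wins_prob_def[abs_def] win_prob_def)
qed

lemma undecided_prob:
  "prob {\<omega>. \<not> wins_within \<omega> n [] \<and> \<not> loses_within \<omega> n []} = 1 - wins_prob n - loses_prob n"
proof -
  have "{\<omega>. \<not> wins_within \<omega> n [] \<and> \<not> loses_within \<omega> n []} =
      UNIV - ({\<omega>. wins_within \<omega> n []} \<union> {\<omega>. loses_within \<omega> n []})"
    by auto
  also have "prob \<dots> = 1 - prob ({\<omega>. wins_within \<omega> n []} \<union> {\<omega>. loses_within \<omega> n []})"
    using events_Collect[OF wins_within_measurable] events_Collect[OF loses_within_measurable]
      prob_compl[of "{\<omega>. wins_within \<omega> n []} \<union> {\<omega>. loses_within \<omega> n []}"] by auto
  also have "\<dots> = 1 - wins_prob n - loses_prob n"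
    using events_Collect[OF wins_within_measurable] events_Collect[OF loses_within_measurable]
      not_wins_and_loses_within
    by (subst finite_measure_Union) (auto simp: wins_prob_def loses_prob_def)
  finally show ?thesis .
qed

lemma undecided_prob_tendsto: "(\<lambda>n. 1 - wins_prob n - loses_prob n) \<longlonglongrightarrow> draw_prob chi p q"
proof -
  let ?U = "\<lambda>n. {\<omega>. \<not> wins_within \<omega> n [] \<and> \<not> loses_within \<omega> n []}"
  have "?U n \<in> events" for n
    by (rule events_Collect) measurable
  then have "(\<lambda>n. prob (?U n)) \<longlonglongrightarrow> prob (\<Inter>n. ?U n)"
    using wins_within_mono loses_within_mono
    by (intro finite_Lim_measure_decseq) (auto simp: decseq_def)
  moreover have "(\<Inter>n. ?U n) = {\<omega>. drawn \<omega>}"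
    by (auto simp: drawn_def won_by_first_iff lost_by_first_iff)
  ultimately show ?thesis
    by (simp add: undecided_prob draw_prob_def)
qed

lemma expected_duration_le:
  "expected_duration chi p q \<le> (\<Sum>n. ennreal (1 - wins_prob n - loses_prob n))"
proof -
  let ?U = "\<lambda>n. {\<omega>. \<not> wins_within \<omega> n [] \<and> \<not> loses_within \<omega> n []}"
  have meas: "?U n \<in> events" for n
    by (rule events_Collect) measurable
  have "expected_duration chi p q \<le> (\<integral>\<^sup>+\<omega>. (\<Sum>n. indicator (?U n) \<omega>) \<partial>game_law)"
    unfolding expected_duration_def by (intro nn_integral_mono duration_le_suminf)
  also have "\<dots> = (\<Sum>n. \<integral>\<^sup>+\<omega>. indicator (?U n) \<omega> \<partial>game_law)"
    using meas by (intro nn_integral_suminf) simp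
  also have "\<dots> = (\<Sum>n. ennreal (1 - wins_prob n - loses_prob n))"
    using meas by (simp add: emeasure_eq_measure undecided_prob)
  finally show ?thesis .
qed

text \<open>For a single child, \<open>lower n\<close> is the probability that its edge is a trap or
  leads safely to a vertex won within \<open>n\<close> rounds; \<open>upper n\<close> is the
  probability that it is a trap or leads safely to a vertex not lost within \<open>n\<close>
  rounds.\<close>

definition "lower n = p + (1 - p - q) * wins_prob n"

definition "upper n = 1 - q - (1 - p - q) * loses_prob n"

lemma lower_Suc: "lower (Suc n) = g_fun chi p q (upper n)"
  by (simp add: lower_def upper_def wins_prob_Suc g_fun_def algebra_simps)

lemma upper_Suc: "upper (Suc n) = g_fun chi p q (lower n)"
  by (simp add: lower_def upper_def loses_prob_Suc g_fun_def)

lemma upper_minus_lower: "upper n - lower n = (1 - p - q) * (1 - wins_prob n - loses_prob n)"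
  by (simp add: lower_def upper_def algebra_simps)

lemma lower_tendsto: "lower \<longlonglongrightarrow> p + (1 - p - q) * win_prob chi p q"
  unfolding lower_def[abs_def]
  by (rule tendsto_add[OF tendsto_const tendsto_mult[OF tendsto_const wins_prob_tendsto]])

lemma lower_le: "lower n \<le> p + (1 - p - q) * win_prob chi p q"
proof (rule incseq_le[OF _ lower_tendsto])
  show "incseq lower"
    unfolding incseq_def lower_def using safe_pos
    by (intro allI impI add_left_mono mult_left_mono wins_prob_mono) simp_all
qed

section \<open>Games without draws: the common limit and geometric decay\<close>

context
  assumes no_draw: "draw_prob chi p q = 0"
begin

text \<open>Here the absence of draws enters: the gap between \<open>upper\<close> and
  \<open>lower\<close> is \<open>1 - p - q\<close> times the probability of being undecided, which
  tends to the draw probability.\<close>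

lemma upper_tendsto: "upper \<longlonglongrightarrow> p + (1 - p - q) * win_prob chi p q"
proof -
  have "(\<lambda>n. lower n + (1 - p - q) * (1 - wins_prob n - loses_prob n)) \<longlonglongrightarrow>
      p + (1 - p - q) * win_prob chi p q + (1 - p - q) * 0"
    using undecided_prob_tendsto unfolding no_draw
    by (rule tendsto_add[OF lower_tendsto tendsto_mult[OF tendsto_const]])
  then show ?thesis
    by (simp add: upper_minus_lower[symmetric])
qed

lemma upper_ge: "p + (1 - p - q) * win_prob chi p q \<le> upper n"
proof (rule decseq_ge[OF _ upper_tendsto])
  show "decseq upper"
    unfolding decseq_def upper_def using safe_pos
    by (intro allI impI diff_left_mono mult_left_mono loses_prob_mono) simp_all
qed

text \<open>By monotonicity the limit lies between \<open>lower 1\<close> and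
  \<open>upper 1\<close>, so it is enough that these are strictly inside the unit interval.
  Differentiability of \<open>pgf\<close> at the limit depends on this.\<close>

lemma limit_in_interior:
  assumes "0 < p + q" and "pmf chi 0 < 1"
  shows "p + (1 - p - q) * win_prob chi p q \<in> {0<..<1}"
proof -
  have "lower 1 = p + (1 - p - q) * (1 - pgf chi (1 - q))"
    by (simp add: lower_def wins_prob_Suc loses_prob_def)
  moreover have "0 < p + (1 - p - q) * (1 - pgf chi (1 - q))"
  \<comment> \<open>If \<open>p = 0\<close>, then \<open>q > 0\<close> and the argument
    \<open>1 - q\<close> is below \<open>1\<close>; as \<open>chi\<close> is not concentrated at
    \<open>0\<close>, \<open>pgf\<close> is below \<open>1\<close> there.\<close>
  proof (cases "p = 0")
    case True
    then have "pgf chi (1 - q) < 1"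
      using assms q_nonneg safe_pos by (intro pgf_less_1) auto
    then show ?thesis
      using True safe_pos by simp
  next
    case False
    moreover have "pgf chi (1 - q) \<le> 1"
      using pgf_le_1 q_nonneg safe_pos p_nonneg by simp
    ultimately show ?thesis
      using p_nonneg safe_pos by (simp add: add_pos_nonneg)
  qed
  moreover have "upper 1 = 1 - q - (1 - p - q) * pgf chi p"
    by (simp add: upper_def loses_prob_Suc wins_prob_def)
  moreover have "0 < q + (1 - p - q) * pgf chi p"
  \<comment> \<open>If \<open>q = 0\<close>, then \<open>p > 0\<close>, and \<open>pgf\<close> is
    positive at \<open>p\<close>.\<close>
  proof (cases "q = 0")
    case True
    then have "0 < pgf chi p"
      using assms safe_pos by (intro pgf_pos) auto
    then show ?thesis
      using True safe_pos by simp
  next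
    case False
    then show ?thesis
      using q_nonneg p_nonneg safe_pos pgf_nonneg[of p chi] by (simp add: add_pos_nonneg)
  qed
  ultimately show ?thesis
    using lower_le[of 1] upper_ge[of 1] by simp
qed

lemma expected_duration_finite:
  assumes w': "w' = p + (1 - p - q) * win_prob chi p q"
    and interior: "w' \<in> {0<..<1}"
    and deriv: "deriv (g_fun chi p q \<circ> g_fun chi p q) w' < 1"
  shows "expected_duration chi p q < \<infinity>"
proof -
  let ?g = "g_fun chi p q"
  define D where "D = deriv ?g w'"
  have "?g field_differentiable at w'"
    unfolding g_fun_def[abs_def] using interior
    by (intro derivative_intros pgf_differentiable) auto
  then have D: "(?g has_field_derivative D) (at w')"
    unfolding D_def by (simp add: field_differentiable_derivI)
  have low: "lower \<longlonglongrightarrow> w'" and up: "upper \<longlonglongrightarrow> w'"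
    using lower_tendsto upper_tendsto w' by simp_all
  have fixed: "?g w' = w'"
  proof (rule LIMSEQ_unique)
    show "(\<lambda>n. ?g (upper n)) \<longlonglongrightarrow> ?g w'"
      using D up by (intro isCont_tendsto_compose[of w' ?g]) (auto intro: DERIV_isCont)
    show "(\<lambda>n. ?g (upper n)) \<longlonglongrightarrow> w'"
      using LIMSEQ_Suc[OF low] by (simp add: lower_Suc)
  qed
  \<comment> \<open>Since \<open>w'\<close> is fixed by \<open>?g\<close>, both factors of the chain
    rule are the derivative at the same point.\<close>
  have "(?g \<circ> ?g has_field_derivative D * D) (at w')"
    using D fixed by (intro DERIV_chain) simp_all
  then have "D * D < 1"
    using deriv by (simp add: DERIV_imp_deriv)
  then have "\<bar>D\<bar> < 1"
    by (simp add: abs_square_less_1[symmetric] power2_eq_square)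
  then obtain c where c: "\<bar>D\<bar> < c" "c < 1"
    using dense by blast
  note contraction = DERIV_eventually_abs_le[OF D c(1)]
  have "\<forall>\<^sub>F n in sequentially. \<bar>?g (lower n) - ?g w'\<bar> \<le> c * \<bar>lower n - w'\<bar> \<and>
      \<bar>?g (upper n) - ?g w'\<bar> \<le> c * \<bar>upper n - w'\<bar>"
    using low up contraction by (intro eventually_conj) (auto simp: filterlim_iff)
  then obtain N where N: "\<And>n. n \<ge> N \<Longrightarrow> \<bar>?g (lower n) - ?g w'\<bar> \<le> c * \<bar>lower n - w'\<bar>"
      "\<And>n. n \<ge> N \<Longrightarrow> \<bar>?g (upper n) - ?g w'\<bar> \<le> c * \<bar>upper n - w'\<bar>"
    by (auto simp: eventually_sequentially)
  have between: "lower n \<le> w'" "w' \<le> upper n" for n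
    using lower_le upper_ge w' by simp_all
  have "summable (\<lambda>n. upper n - lower n)"
  proof (rule summable_ratio_test[OF c(2)])
    fix n assume "n \<ge> N"
    \<comment> \<open>\<open>?g\<close> exchanges the two sides of \<open>w'\<close>. As
      \<open>w'\<close> lies between \<open>lower n\<close> and \<open>upper n\<close>, the gap is
      the sum of their distances to \<open>w'\<close>; the triangle inequality through
      \<open>?g w'\<close> bounds the next gap by \<open>c\<close> times that sum.\<close>
    from N[OF this] show "norm (upper (Suc n) - lower (Suc n)) \<le> c * norm (upper n - lower n)"
      using between[of n] between[of "Suc n"]
      by (simp add: upper_Suc lower_Suc algebra_simps)
  qed
  then have "summable (\<lambda>n. 1 - wins_prob n - loses_prob n)"
    using safe_pos by (simp add: upper_minus_lower)
  moreover have "0 \<le> 1 - wins_prob n - loses_prob n" for n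
    unfolding undecided_prob[symmetric] by simp
  ultimately have "(\<Sum>n. ennreal (1 - wins_prob n - loses_prob n)) < \<infinity>"
    by (simp add: suminf_ennreal2)
  then show ?thesis
    using expected_duration_le by (rule order.strict_trans1[rotated])
qed

end

end

theorem theorem1p7:
  fixes chi :: "nat pmf" and p q w w' :: real
  assumes "0 \<le> pmf chi 0" and "pmf chi 0 < 1"
    and "p \<in> {0..1}" and "q \<in> {0..1}"
    and "0 < p + q" and "p + q < 1"
    and "w = win_prob chi p q"
    and "w' = p + (1 - p - q) * w"
    and "draw_prob chi p q = 0"
    and "deriv (g_fun chi p q) w' < 1"
    and "deriv (g_fun chi p q \<circ> g_fun chi p q) w' < 1"
  shows "expected_duration chi p q < \<infinity>"
proof -
  interpret percolation_parameters chi p q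
    using assms(3,4,6) by unfold_locales auto
  have w': "w' = p + (1 - p - q) * win_prob chi p q"
    using assms(7,8) by simp
  then have "w' \<in> {0<..<1}"
    using limit_in_interior[OF assms(9,5,2)] by simp
  with w' show ?thesis
    using expected_duration_finite[OF assms(9) _ _ assms(11)] by blast
qed

end
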